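(* Let $\mathbb{K}$ be an arbitrary (commutative) field and let $H$ be a maximal linear subspace of $\mathrm{M}_n(\mathbb{K})$ with a trivial spectrum. Then there are irreducible maximal linear subspaces $V_1,\dots,V_p$ with trivial spectra (each $V_k$ being a subspace of $\mathrm{M}_{n_k}(\mathbb{K})$ for some positive integer $n_k$, with $n_1+\cdots+n_p=n$) such that $$H\simeq V_1\vee V_2\vee\cdots\vee V_p.$$
   Context: $\mathrm{M}_n(\mathbb{K})$ is the algebra of $n\times n$ matrices over $\mathbb{K}$. A linear subspace $H$ of $\mathrm{M}_n(\mathbb{K})$ has a trivial spectrum if no matrix $M\in H$ has a non-zero vector $X\in\mathbb{K}^n$ with $MX=X$. Such a subspace is called maximal if its dimension is $\binom{n}{2}$. (It is a known theorem that, over any field, a linear subspace of $\mathrm{M}_n(\mathbb{K})$ with a trivial spectrum has dimension at most $\binom{n}{2}$.) A maximal linear subspace with a trivial spectrum is irreducible if the only linear subspaces of $\mathbb{K}^n$ that are stabilized by all its matrices are $\{0\}$ and $\mathbb{K}^n$. Two linear subspaces $V,W$ of $\mathrm{M}_n(\mathbb{K})$ are similar, written $V\simeq W$, if $W=RVR^{-1}$ for some $R\in\mathrm{GL}_n(\mathbb{K})$. For subsets $V\subset \mathrm{M}_n(\mathbb{K})$ and $W\subset \mathrm{M}_p(\mathbb{K})$, $V\vee W:=\left\{\begin{bmatrix}A&B\\0&C\end{bmatrix} \mid A\in V,\ B\in \mathrm{M}_{n,p}(\mathbb{K}),\ C\in W\right\}\subset \mathrm{M}_{n+p}(\mathbb{K})$,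 where $\mathrm{M}_{n,p}(\mathbb{K})$ is the space of $n\times p$ matrices; the operation $\vee$ is associative. *)

theory Defs
  imports "Jordan_Normal_Form.VS_Connect"
begin

definition mat_subspace :: "nat \<Rightarrow> 'a::field mat set \<Rightarrow> bool" where
  "mat_subspace n H \<longleftrightarrow> subspace class_ring H (module_mat TYPE('a) n n)"

definition mat_subspace_dim :: "nat \<Rightarrow> 'a::field mat set \<Rightarrow> nat" where
  "mat_subspace_dim n H =
     vectorspace.dim class_ring ((module_mat TYPE('a) n n)\<lparr>carrier := H\<rparr>)"

definition trivial_spectrum :: "nat \<Rightarrow> 'a::field mat set \<Rightarrow> bool" where
  "trivial_spectrum n H \<longleftrightarrow> mat_subspace n H \<and>
     (\<forall>M\<in>H. \<not> (\<exists>X\<in>carrier_vec n. X \<noteq> 0\<^sub>v n \<and> M *\<^sub>v X = X))"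

definition maximal_trivial_spectrum :: "nat \<Rightarrow> 'a::field mat set \<Rightarrow> bool" where
  "maximal_trivial_spectrum n H \<longleftrightarrow>
     trivial_spectrum n H \<and> mat_subspace_dim n H = n choose 2"

definition irreducible_maximal_trivial_spectrum :: "nat \<Rightarrow> 'a::field mat set \<Rightarrow> bool" where
  "irreducible_maximal_trivial_spectrum n H \<longleftrightarrow> maximal_trivial_spectrum n H \<and>
     (\<forall>U. subspace class_ring U (module_vec TYPE('a) n) \<and> (\<forall>M\<in>H. \<forall>X\<in>U. M *\<^sub>v X \<in> U)
        \<longrightarrow> U = {0\<^sub>v n} \<or> U = carrier_vec n)"

definition similar_mat_sets :: "nat \<Rightarrow> 'a::field mat set \<Rightarrow> 'a mat set \<Rightarrow> bool" where
  "similar_mat_sets n V W \<longleftrightarrow>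
     (\<exists>R\<in>carrier_mat n n. \<exists>S\<in>carrier_mat n n. inverts_mat R S \<and> inverts_mat S R \<and>
        W = (\<lambda>M. R * M * S) ` V)"

text \<open>The type of matrices does not record sizes, so the join of \<open>V \<subseteq> M\<^sub>n(K)\<close> and
  \<open>W \<subseteq> M\<^sub>p(K)\<close> takes \<open>n\<close> and \<open>p\<close> as arguments; a family of sets is given
  as a list of pairs of a size and a set of square matrices of that size.\<close>

definition mat_join :: "nat \<Rightarrow> nat \<Rightarrow> 'a::zero mat set \<Rightarrow> 'a mat set \<Rightarrow> 'a mat set" where
  "mat_join n p V W =
     {four_block_mat A B (0\<^sub>m p n) C | A B C. A \<in> V \<and> B \<in> carrier_mat n p \<and> C \<in> W}"

text \<open>The empty join is the neutral element of the operation, the one-element set \<open>M\<^sub>0(K)\<close>.\<close>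

fun mat_joins :: "(nat \<times> 'a::zero mat set) list \<Rightarrow> 'a mat set" where
  "mat_joins [] = carrier_mat 0 0"
| "mat_joins [(n, V)] = V"
| "mat_joins ((n, V) # W # Ws) =
     mat_join n (sum_list (map fst (W # Ws))) V (mat_joins (W # Ws))"

end

theory Submission
  imports Defs "Jordan_Normal_Form.DL_Rank"
begin

text \<open>The bound \<open>dim H \<le> n choose 2\<close> for trivial spectrum spaces is proved by induction on \<open>n\<close>: some basis
  vector \<open>e\<^sub>i\<close> spans the range of no nonzero matrix of \<open>H\<close>. Then \<open>{M e\<^sub>i | M \<in> H}\<close> misses \<open>e\<^sub>i\<close>, so has
  dimension at most \<open>n - 1\<close>, and \<open>{M \<in> H. M e\<^sub>i = 0}\<close> acts faithfully, with trivial spectrum, on the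
  quotient by \<open>e\<^sub>i\<close>.

  For a maximal \<open>H\<close>, choose the least \<open>m > 0\<close> such that \<open>H\<close> is similar to a space of block upper
  triangular matrices with an upper left block of size \<open>m\<close>. Both families of diagonal blocks have
  trivial spectrum, so by the bound and a dimension count the space is the full join of the two and
  both are maximal. Leastness of \<open>m\<close> makes the first irreducible; induction handles the second.\<close>

subsection \<open>Spaces of matrices and their dimension\<close>

text \<open>Independence inside \<open>W\<close> agrees with independence inside \<open>V\<close>,
  so independent subsets of \<open>W\<close> have at most \<open>dim\<close> elements. Hence a
  maximal one exists, and it is a basis of \<open>W\<close>.\<close>

lemma (in vectorspace) subspace_basis_exists:
  assumes fd: "fin_dim" and W: "subspace K W V"
  obtains B where "finite B" "B \<subseteq> W" "lin_indpt B" "span B = W"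
    "card B = vectorspace.dim K (vs W)" "vectorspace.fin_dim K (vs W)"
proof -
  interpret W: vectorspace K "vs W" using W by (rule subspace_is_vs)
  have sub: "submodule K W V" using W by simp
  then have WV: "W \<subseteq> carrier V" by (rule submodule.subset)
  note transfer = span_li_not_depend[OF _ sub]
  have bounded: "finite A \<and> card A \<le> dim" if "A \<subseteq> carrier (vs W) \<and> W.lin_indpt A" for A
  proof -
    from that have "A \<subseteq> W" "lin_indpt A" using transfer(2)[of A] by auto
    then show ?thesis using li_le_dim[OF fd, of A] WV by blast
  qed
  have "W.lin_indpt {}" unfolding W.lin_dep_def by auto
  then obtain B where B: "finite B" "maximal B (\<lambda>S. S \<subseteq> carrier (vs W) \<and> W.lin_indpt S)"
    using maximal_exists[of "\<lambda>S. S \<subseteq> carrier (vs W) \<and> W.lin_indpt S" dim "{}"] bounded by blast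
  from W.max_li_is_basis[OF B(2)] have bas: "W.basis B" .
  then have BW: "B \<subseteq> W" unfolding W.basis_def by simp
  show thesis
  proof (rule that[OF B(1) BW])
    show "lin_indpt B" "span B = W"
      using bas transfer[OF BW] unfolding W.basis_def by auto
    show "card B = W.dim" using W.dim_basis[OF B(1) bas] by simp
    show "W.fin_dim" using bas B(1) unfolding W.fin_dim_def W.basis_def by blast
  qed
qed

lemma (in vectorspace) subspace_dim_le:
  assumes "fin_dim" and "subspace K W V"
  shows "vectorspace.dim K (vs W) \<le> dim"
  using assms subspace_basis_exists subspace_dim by metis

text \<open>A basis of \<open>W\<close> is an independent subset of \<open>V\<close> with
  \<open>dim\<close> elements, hence already a basis of \<open>V\<close>.\<close>

lemma (in vectorspace) subspace_dim_eq_imp_eq: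
  assumes fd: "fin_dim" and W: "subspace K W V" and dim: "vectorspace.dim K (vs W) = dim"
  shows "W = carrier V"
proof -
  obtain B where B: "finite B" "B \<subseteq> W" "lin_indpt B" "span B = W"
    "card B = vectorspace.dim K (vs W)" using subspace_basis_exists[OF fd W] .
  have "W \<subseteq> carrier V" using submodule.subset[OF is_module[OF W]] .
  then have "basis B" using dim_li_is_basis[OF fd B(1) _ B(3)] B dim by auto
  then show ?thesis using B(4) unfolding basis_def by simp
qed

section \<open>The dimension of the space of all a by b matrices\<close>

definition vec_to_mat :: "nat \<Rightarrow> nat \<Rightarrow> 'a vec \<Rightarrow> 'a mat" where
  "vec_to_mat a b v = mat a b (\<lambda>(i, j). v $ (i * b + j))"

text \<open>The dimension is carried over from vectors of length \<open>a * b\<close> along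
  \<open>vec_to_mat\<close>, which fills a matrix row by row; quotient and remainder by
  \<open>b\<close> recover the two indices.\<close>

lemma module_mat_dim:
  "vectorspace.fin_dim class_ring (module_mat TYPE('a::field) a b)"
  "vectorspace.dim class_ring (module_mat TYPE('a::field) a b) = a * b"
proof -
  interpret vec_space "TYPE('a)" "a * b" .
  have lt: "i * b + j < a * b" if "i < a" "j < b" for i j
  proof -
    have "Suc i * b \<le> a * b" using that by (intro mult_le_mono1) simp
    then show ?thesis using that by simp
  qed
  have "LinearCombinations.module_hom class_ring V (module_mat TYPE('a) a b) = 
     {f. f \<in> carrier_vec (a*b) \<rightarrow> carrier_mat a b
      \<and> (\<forall>u\<in>carrier_vec (a*b). \<forall>v\<in>carrier_vec (a*b). f (u + v) = f u + f v) 
      \<and> (\<forall>c. \<forall>v\<in>carrier_vec (a*b). f (c \<cdot>\<^sub>v v) = c \<cdot>\<^sub>m f v)}"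
    unfolding LinearCombinations.module_hom_def by (auto simp: module_mat_simps class_ring_simps module_vec_simps)
  moreover have "vec_to_mat a b \<in> \<dots>"
    using lt by (auto simp: vec_to_mat_def intro!: eq_matI)
  ultimately have hom: "vec_to_mat a b \<in> LinearCombinations.module_hom class_ring V (module_mat TYPE('a) a b)" by simp
  interpret linear_map class_ring V "module_mat TYPE('a) a b" "vec_to_mat a b"
    using hom matrix_vs[where 'a='a] vec_vs
    unfolding linear_map_def mod_hom_def mod_hom_axioms_def vectorspace_def by blast
  have inj: "inj_on (vec_to_mat a b) (carrier V)"
  proof (rule inj_onI)
    fix u v :: "'a vec" assume u: "u \<in> carrier V" and v: "v \<in> carrier V"
      and eq: "vec_to_mat a b u = vec_to_mat a b v"
    show "u = v"
    proof (rule eq_vecI)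
      fix k assume "k < dim_vec v"
      then have k: "k < a * b" using v by auto
      then have "b > 0" by (cases b) auto
      have "k div b < a" using k by (simp add: less_mult_imp_div_less)
      have "k mod b < b" using \<open>b > 0\<close> by simp
      have "vec_to_mat a b u $$ (k div b, k mod b) = vec_to_mat a b v $$ (k div b, k mod b)"
        using eq by simp
      then show "u $ k = v $ k" using \<open>k div b < a\<close> \<open>k mod b < b\<close> by (simp add: vec_to_mat_def)
    qed (use u v in auto)
  qed
  have surj: "vec_to_mat a b ` carrier V = carrier (module_mat TYPE('a) a b)"
  proof (intro equalityI subsetI)
    fix M assume M: "M \<in> carrier (module_mat TYPE('a) a b)"
    let ?v = "vec (a * b) (\<lambda>k. M $$ (k div b, k mod b))"
    have "M = vec_to_mat a b ?v"
      using M lt by (auto simp: vec_to_mat_def module_mat_simps intro!: eq_matI)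
    then show "M \<in> vec_to_mat a b ` carrier V" by auto
  qed (auto simp: vec_to_mat_def module_mat_simps)
  show "vectorspace.fin_dim class_ring (module_mat TYPE('a::field) a b)"
    by (rule surj_fin_dim[OF fin_dim surj])
  show "vectorspace.dim class_ring (module_mat TYPE('a::field) a b) = a * b"
    using dim_eq[OF fin_dim inj surj] dim_is_n by simp
qed

section \<open>Subspaces of rectangular matrices and rank-nullity\<close>

text \<open>The rectangular counterpart of \<open>mat_subspace\<close>: single columns and upper
  right blocks need not be square.\<close>

definition mat_space :: "nat \<Rightarrow> nat \<Rightarrow> 'a::field mat set \<Rightarrow> bool" where
  "mat_space a b H \<longleftrightarrow> subspace class_ring H (module_mat TYPE('a) a b)"

definition mat_dim :: "nat \<Rightarrow> nat \<Rightarrow> 'a::field mat set \<Rightarrow> nat" where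
  "mat_dim a b H = vectorspace.dim class_ring ((module_mat TYPE('a) a b)\<lparr>carrier := H\<rparr>)"

text \<open>Linearity is asked on \<open>H\<close> only, because the type of matrices contains all
  sizes and addition behaves well only between equal sizes.\<close>

definition mat_linear_on :: "'a::field mat set \<Rightarrow> nat \<Rightarrow> nat \<Rightarrow> ('a mat \<Rightarrow> 'a mat) \<Rightarrow> bool" where
  "mat_linear_on H c d f \<longleftrightarrow> f ` H \<subseteq> carrier_mat c d \<and>
     (\<forall>M\<in>H. \<forall>N\<in>H. f (M + N) = f M + f N) \<and> (\<forall>k. \<forall>M\<in>H. f (k \<cdot>\<^sub>m M) = k \<cdot>\<^sub>m f M)"

lemma mat_space_iff:
  fixes H :: "'a::field mat set"
  shows "mat_space a b H \<longleftrightarrow> H \<subseteq> carrier_mat a b \<and> 0\<^sub>m a b \<in> H \<and>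
     (\<forall>M\<in>H. \<forall>N\<in>H. M + N \<in> H) \<and> (\<forall>k. \<forall>M\<in>H. k \<cdot>\<^sub>m M \<in> H)"
  using matrix_vs[where 'a='a, of a b]
  unfolding mat_space_def VectorSpace.subspace_def submodule_def vectorspace_def
  by (auto simp: module_mat_simps class_ring_simps)

lemma mat_spaceD:
  assumes "mat_space a b H"
  shows "H \<subseteq> carrier_mat a b" "0\<^sub>m a b \<in> H" "M \<in> H \<Longrightarrow> N \<in> H \<Longrightarrow> M + N \<in> H"
    "M \<in> H \<Longrightarrow> k \<cdot>\<^sub>m M \<in> H" "M \<in> H \<Longrightarrow> M \<in> carrier_mat a b"
  using assms unfolding mat_space_iff by auto

lemma mat_space_diff:
  fixes H :: "'a::field mat set"
  assumes H: "mat_space a b H" and M: "M \<in> H" and N: "N \<in> H"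
  shows "M - N \<in> H"
proof -
  have "M - N = M + (-1) \<cdot>\<^sub>m N"
    using mat_spaceD(5)[OF H M] mat_spaceD(5)[OF H N] by (intro eq_matI) auto
  then show ?thesis using mat_spaceD(3,4)[OF H] M N by simp
qed

lemma mat_space_carrier: "mat_space a b (carrier_mat a b)"
  unfolding mat_space_iff by auto

lemma mat_dim_carrier: "mat_dim a b (carrier_mat a b :: 'a::field mat set) = a * b"
proof -
  have "(module_mat TYPE('a) a b)\<lparr>carrier := carrier_mat a b\<rparr> = module_mat TYPE('a) a b"
    unfolding module_mat_def by simp
  then show ?thesis unfolding mat_dim_def using module_mat_dim(2)[where 'a='a] by simp
qed

lemma mat_space_finite_dim:
  fixes H :: "'a::field mat set"
  assumes "mat_space a b H"
  shows "vectorspace class_ring ((module_mat TYPE('a) a b)\<lparr>carrier := H\<rparr>)"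
    "vectorspace.fin_dim class_ring ((module_mat TYPE('a) a b)\<lparr>carrier := H\<rparr>)"
proof -
  interpret V: vectorspace class_ring "module_mat TYPE('a) a b" by (rule matrix_vs)
  note H = assms[unfolded mat_space_def]
  show "vectorspace class_ring (V.vs H)" by (rule V.subspace_is_vs[OF H])
  show "vectorspace.fin_dim class_ring (V.vs H)"
    using V.subspace_basis_exists[OF module_mat_dim(1) H] by metis
qed

lemma mat_dim_subspace:
  fixes H G :: "'a::field mat set"
  assumes G: "mat_space a b G" and H: "mat_space a b H" and GH: "G \<subseteq> H"
  shows "mat_dim a b G \<le> mat_dim a b H" "mat_dim a b G = mat_dim a b H \<Longrightarrow> G = H"
proof -
  interpret V: vectorspace class_ring "module_mat TYPE('a) a b" by (rule matrix_vs)
  interpret H: vectorspace class_ring "V.vs H" by (rule mat_space_finite_dim[OF H])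
  have sub: "subspace class_ring G (V.vs H)"
    using V.nested_subspaces G H GH unfolding mat_space_def by blast
  note fd = mat_space_finite_dim(2)[OF H]
  show "mat_dim a b G \<le> mat_dim a b H"
    using H.subspace_dim_le[OF fd sub] unfolding mat_dim_def by simp
  show "G = H" if "mat_dim a b G = mat_dim a b H"
    using H.subspace_dim_eq_imp_eq[OF fd sub] that unfolding mat_dim_def by simp
qed

lemma mat_dim_le:
  assumes "mat_space a b H"
  shows "mat_dim a b H \<le> a * b" "mat_dim a b H = a * b \<Longrightarrow> H = carrier_mat a b"
  using mat_dim_subspace[OF assms mat_space_carrier mat_spaceD(1)[OF assms]]
  by (simp_all add: mat_dim_carrier)

text \<open>The domain of the linear map is \<open>H\<close> itself, regarded as a vector space. The
  dimension counts below all rest on this equation.\<close>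

lemma mat_rank_nullity:
  fixes H :: "'a::field mat set"
  assumes H: "mat_space a b H" and f: "mat_linear_on H c d f"
  shows "mat_space c d (f ` H)" "mat_space a b {M \<in> H. f M = 0\<^sub>m c d}"
    "mat_dim a b H = mat_dim c d (f ` H) + mat_dim a b {M \<in> H. f M = 0\<^sub>m c d}"
proof -
  let ?V = "(module_mat TYPE('a) a b)\<lparr>carrier := H\<rparr>" and ?W = "module_mat TYPE('a) c d"
  have hom: "f \<in> LinearCombinations.module_hom class_ring ?V ?W"
    using f unfolding LinearCombinations.module_hom_def mat_linear_on_def
    by (auto simp: module_mat_simps class_ring_simps)
  interpret T: linear_map class_ring ?V ?W f
    using hom matrix_vs[where 'a='a, of c d] mat_space_finite_dim(1)[OF H]
    unfolding linear_map_def mod_hom_def mod_hom_axioms_def vectorspace_def by blast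
  have ker: "T.kerT = {M \<in> H. f M = 0\<^sub>m c d}" unfolding T.ker_def by (simp add: module_mat_simps)
  have im: "T.imT = f ` H" unfolding T.im_def by simp
  show "mat_space c d (f ` H)" using T.imT_is_subspace unfolding im mat_space_def .
  have "subspace class_ring {M \<in> H. f M = 0\<^sub>m c d} ?V" using T.kerT_is_subspace unfolding ker .
  then show "mat_space a b {M \<in> H. f M = 0\<^sub>m c d}"
    using H unfolding mat_space_iff VectorSpace.subspace_def submodule_def
    by (auto simp: module_mat_simps class_ring_simps)
  show "mat_dim a b H = mat_dim c d (f ` H) + mat_dim a b {M \<in> H. f M = 0\<^sub>m c d}"
    using T.rank_nullity[OF mat_space_finite_dim(2)[OF H]] unfolding ker im mat_dim_def by simp
qed

text \<open>The index maps are arbitrary, so that one linearity lemma serves single columns, the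
  deletion of a row and a column, and the blocks of a block matrix.\<close>

definition select_mat :: "nat \<Rightarrow> nat \<Rightarrow> (nat \<Rightarrow> nat) \<Rightarrow> (nat \<Rightarrow> nat) \<Rightarrow> 'a mat \<Rightarrow> 'a mat" where
  "select_mat c d p q M = mat c d (\<lambda>(i, j). M $$ (p i, q j))"

lemma select_mat_index [simp]:
  "i < c \<Longrightarrow> j < d \<Longrightarrow> select_mat c d p q M $$ (i, j) = M $$ (p i, q j)"
  "dim_row (select_mat c d p q M) = c" "dim_col (select_mat c d p q M) = d"
  unfolding select_mat_def by simp_all

lemma select_mat_carrier [simp]: "select_mat c d p q M \<in> carrier_mat c d"
  unfolding select_mat_def by simp

lemma select_mat_linear:
  assumes H: "H \<subseteq> carrier_mat a b"
    and p: "\<And>i. i < c \<Longrightarrow> p i < a" and q: "\<And>j. j < d \<Longrightarrow> q j < b"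
  shows "mat_linear_on H c d (select_mat c d p q)"
proof -
  have "select_mat c d p q (M + N) = select_mat c d p q M + select_mat c d p q N"
    if "M \<in> H" "N \<in> H" for M N
  proof -
    have "M \<in> carrier_mat a b" "N \<in> carrier_mat a b" using that H by auto
    then show ?thesis using p q by (intro eq_matI) auto
  qed
  moreover have "select_mat c d p q (k \<cdot>\<^sub>m M) = k \<cdot>\<^sub>m select_mat c d p q M" if "M \<in> H" for k M
  proof -
    have "M \<in> carrier_mat a b" using that H by auto
    then show ?thesis using p q by (intro eq_matI) auto
  qed
  ultimately show ?thesis unfolding mat_linear_on_def by auto
qed

text \<open>Rank-nullity for the identity on the zero space reads d = d + d.\<close>

lemma mat_dim_zero: "mat_dim a b {0\<^sub>m a b :: 'a::field mat} = 0"
proof -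
  let ?Z = "{0\<^sub>m a b :: 'a mat}"
  have Z: "mat_space a b ?Z" unfolding mat_space_iff by auto
  have lin: "mat_linear_on ?Z a b (\<lambda>M. M)" unfolding mat_linear_on_def by auto
  have "{M \<in> ?Z. M = 0\<^sub>m a b} = ?Z" by auto
  then show ?thesis using mat_rank_nullity(3)[OF Z lin] by simp
qed

lemma mat_dim_inj_image:
  assumes H: "mat_space a b H" and f: "mat_linear_on H c d f"
    and inj: "\<And>M. M \<in> H \<Longrightarrow> f M = 0\<^sub>m c d \<Longrightarrow> M = 0\<^sub>m a b"
  shows "mat_dim c d (f ` H) = mat_dim a b H"
proof -
  have "{M \<in> H. f M = 0\<^sub>m c d} = {0\<^sub>m a b}"
    using inj mat_spaceD(2)[OF mat_rank_nullity(2)[OF H f]] by auto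
  then show ?thesis using mat_rank_nullity(3)[OF H f] mat_dim_zero by simp
qed

lemma mat_subspace_iff_mat_space: "mat_subspace n H \<longleftrightarrow> mat_space n n H"
  unfolding mat_subspace_def mat_space_def ..

lemma mat_subspace_dim_eq_mat_dim: "mat_subspace_dim n H = mat_dim n n H"
  unfolding mat_subspace_dim_def mat_dim_def ..

section \<open>Trivial spectrum in terms of determinants\<close>

text \<open>A fixed vector of \<open>M\<close> is a kernel vector of \<open>M - 1\<close>. The
  determinant form gives access to Laplace expansion, block determinants and
  multiplicativity.\<close>

lemma fixed_vector_iff_det:
  fixes M :: "'a::field mat"
  assumes M: "M \<in> carrier_mat n n"
  shows "(\<exists>X\<in>carrier_vec n. X \<noteq> 0\<^sub>v n \<and> M *\<^sub>v X = X) \<longleftrightarrow> det (M - 1\<^sub>m n) = 0"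
proof -
  have "(M - 1\<^sub>m n) *\<^sub>v X = 0\<^sub>v n \<longleftrightarrow> M *\<^sub>v X = X" if X: "X \<in> carrier_vec n" for X
  proof -
    have "(M - 1\<^sub>m n) *\<^sub>v X = M *\<^sub>v X - X"
      using M X by (simp add: minus_mult_distrib_mat_vec)
    moreover have "M *\<^sub>v X - X = 0\<^sub>v n \<longleftrightarrow> M *\<^sub>v X = X"
      using M X by (auto simp: vec_eq_iff)
    ultimately show ?thesis by simp
  qed
  moreover have "M - 1\<^sub>m n \<in> carrier_mat n n" by (rule minus_carrier_mat[OF one_carrier_mat])
  ultimately show ?thesis unfolding det_0_iff_vec_prod_zero[OF \<open>M - 1\<^sub>m n \<in> carrier_mat n n\<close>] by blast
qed

lemma trivial_spectrum_iff_det: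
  "trivial_spectrum n H \<longleftrightarrow> mat_space n n H \<and> (\<forall>M\<in>H. det (M - 1\<^sub>m n) \<noteq> 0)"
  unfolding trivial_spectrum_def mat_subspace_iff_mat_space
  using fixed_vector_iff_det mat_spaceD(5) by metis

lemma maximal_trivial_spectrum_iff:
  "maximal_trivial_spectrum n H \<longleftrightarrow> trivial_spectrum n H \<and> mat_dim n n H = n choose 2"
  unfolding maximal_trivial_spectrum_def mat_subspace_dim_eq_mat_dim ..

subsection \<open>The dimension bound\<close>

text \<open>Take \<open>S\<close> minimal among the nonempty subsets of \<open>A\<close> in which
  every vertex has a successor. Every choice of successors within \<open>S\<close> then permutes
  \<open>S\<close>, which leaves no room for a second choice at any vertex.\<close>

lemma ex_subset_unique_successor:
  assumes fin: "finite A" and ne: "A \<noteq> {}" and succ: "\<And>i. i \<in> A \<Longrightarrow> \<exists>j\<in>A. r i j"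
  shows "\<exists>S\<subseteq>A. S \<noteq> {} \<and> (\<forall>i\<in>S. \<exists>!j. j \<in> S \<and> r i j)"
proof -
  let ?P = "\<lambda>S. S \<subseteq> A \<and> S \<noteq> {} \<and> (\<forall>i\<in>S. \<exists>j\<in>S. r i j)"
  have "finite {S. ?P S}" using fin by (simp add: finite_subset[of _ "Pow A"] subset_iff)
  moreover have "{S. ?P S} \<noteq> {}" using ne succ by blast
  ultimately obtain S where "S \<in> {S. ?P S}" "\<forall>T\<in>{S. ?P S}. T \<subseteq> S \<longrightarrow> S = T"
    by (rule finite_has_minimal[THEN bexE])
  then have S: "?P S" and min: "\<And>T. ?P T \<Longrightarrow> T \<subseteq> S \<Longrightarrow> T = S" by auto
  have finS: "finite S" using S fin finite_subset by blast
  have inj: "f ` S = S \<and> inj_on f S" if f: "\<And>i. i \<in> S \<Longrightarrow> f i \<in> S \<and> r i (f i)" for f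
  proof -
    \<comment> \<open>A vertex of the image is sent by \<open>f\<close> into the image again, so
      minimality of \<open>S\<close> applies.\<close>
    have "?P (f ` S)" using f S by blast
    then have "f ` S = S" using min[of "f ` S"] f by blast
    then show ?thesis using finite_surj_inj[OF finS, of f] by simp
  qed
  obtain f where f: "\<And>i. i \<in> S \<Longrightarrow> f i \<in> S \<and> r i (f i)" using S by metis
  have unique: "j = f i" if i: "i \<in> S" and j: "j \<in> S" "r i j" for i j
  proof (rule ccontr)
    assume "j \<noteq> f i"
    \<comment> \<open>Here \<open>k\<close> differs from \<open>i\<close>, as \<open>f i\<close> is
      not \<open>j\<close>. Once \<open>i\<close> is redirected to \<open>j\<close>, both
      \<open>i\<close> and \<open>k\<close> go to \<open>j\<close>, although the redirected map is
      injective too.\<close>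
    moreover obtain k where "k \<in> S" "f k = j" using inj[OF f] j by (metis image_iff)
    moreover have "inj_on (f(i := j)) S" using inj[of "f(i := j)"] f j by simp
    ultimately show False using i by (metis fun_upd_other fun_upd_same inj_onD)
  qed
  have "\<exists>!j. j \<in> S \<and> r i j" if i: "i \<in> S" for i
    using f[OF i] unique[OF i] by (intro ex1I[of _ "f i"]) auto
  then show ?thesis using S by (intro exI[of _ S]) simp
qed

text \<open>Closure under linear combinations, stated through entries so that the sum is one of
  scalars.\<close>

lemma mat_space_sum:
  assumes H: "mat_space a b H" and fin: "finite S" and N: "\<And>i. i \<in> S \<Longrightarrow> N i \<in> H"
  shows "\<exists>M\<in>H. \<forall>k<a. \<forall>j<b. M $$ (k, j) = (\<Sum>i\<in>S. c i * N i $$ (k, j))"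
  using fin N
proof (induction S)
  case empty
  then show ?case using mat_spaceD(2)[OF H] by (intro bexI[of _ "0\<^sub>m a b"]) auto
next
  case (insert s S)
  then obtain M where M: "M \<in> H" "\<forall>k<a. \<forall>j<b. M $$ (k, j) = (\<Sum>i\<in>S. c i * N i $$ (k, j))"
    by auto
  have Ns: "N s \<in> H" using insert by simp
  have "c s \<cdot>\<^sub>m N s + M \<in> H" using M Ns mat_spaceD(3,4)[OF H] by simp
  then show ?case
    using M insert mat_spaceD(5)[OF H M(1)] mat_spaceD(5)[OF H Ns]
    by (intro bexI[of _ "c s \<cdot>\<^sub>m N s + M"]) auto
qed

text \<open>If every row index \<open>i\<close> supported a nonzero \<open>N\<^sub>i \<in> H\<close> concentrated on row \<open>i\<close>, join \<open>i\<close> to the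
  columns of its nonzero entries. On a minimal nonempty set \<open>S\<close> without sinks every vertex has a
  single successor, so a suitable combination of the \<open>N\<^sub>i\<close> fixes the indicator vector of \<open>S\<close>.\<close>
lemma trivial_spectrum_ex_good_row:
  fixes H :: "'a::field mat set"
  assumes H: "trivial_spectrum n H" and n: "n > 0"
  shows "\<exists>i<n. \<forall>M\<in>H. (\<forall>k<n. \<forall>j<n. k \<noteq> i \<longrightarrow> M $$ (k, j) = 0) \<longrightarrow> M = 0\<^sub>m n n"
proof (rule ccontr)
  assume "\<not> ?thesis"
  then have "\<forall>i<n. \<exists>M\<in>H. (\<forall>k<n. \<forall>j<n. k \<noteq> i \<longrightarrow> M $$ (k, j) = 0) \<and> M \<noteq> 0\<^sub>m n n"
    by blast
  then obtain N where N: "\<And>i. i < n \<Longrightarrow> N i \<in> H"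
      "\<And>i k j. i < n \<Longrightarrow> k < n \<Longrightarrow> j < n \<Longrightarrow> k \<noteq> i \<Longrightarrow> N i $$ (k, j) = 0"
      "\<And>i. i < n \<Longrightarrow> N i \<noteq> 0\<^sub>m n n"
    by metis
  have sp: "mat_space n n H" using H unfolding trivial_spectrum_iff_det by simp
  have "\<exists>j\<in>{..<n}. N i $$ (i, j) \<noteq> 0" if "i \<in> {..<n}" for i
  proof (rule ccontr)
    assume "\<not> ?thesis"
    then have "N i $$ (k, j) = 0" if "k < n" "j < n" for k j
      using N(2)[of i k j] that \<open>i \<in> {..<n}\<close> by (cases "k = i") auto
    then have "N i = 0\<^sub>m n n" using mat_spaceD(5)[OF sp N(1)[of i]] that by (intro eq_matI) auto
    then show False using N(3)[of i] that by simp
  qed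
  then obtain S where S: "S \<subseteq> {..<n}" "S \<noteq> {}"
    and uniq: "\<forall>i\<in>S. \<exists>!j. j \<in> S \<and> N i $$ (i, j) \<noteq> 0"
    using ex_subset_unique_successor[of "{..<n}" "\<lambda>i j. N i $$ (i, j) \<noteq> 0"] n by blast
  then obtain f where f: "\<And>i. i \<in> S \<Longrightarrow> f i \<in> S \<and> N i $$ (i, f i) \<noteq> 0"
      "\<And>i j. i \<in> S \<Longrightarrow> j \<in> S \<Longrightarrow> j \<noteq> f i \<Longrightarrow> N i $$ (i, j) = 0"
    by metis
  have fin: "finite S" using S(1) finite_subset by blast
  \<comment> \<open>This scales to 1 the only nonzero entry that \<open>N i\<close> has in row
    \<open>i\<close> and the columns from \<open>S\<close>.\<close>
  let ?c = "\<lambda>i. 1 / N i $$ (i, f i)"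
  obtain M where M: "M \<in> H"
    "\<And>k j. k < n \<Longrightarrow> j < n \<Longrightarrow> M $$ (k, j) = (\<Sum>i\<in>S. ?c i * N i $$ (k, j))"
    using mat_space_sum[OF sp fin, of N ?c] N(1) S(1) by blast
  have Mc: "M \<in> carrier_mat n n" using mat_spaceD(5)[OF sp M(1)] .
  \<comment> \<open>Since \<open>N i\<close> vanishes off row \<open>i\<close>, row \<open>k\<close>
    of \<open>M\<close> comes from \<open>N k\<close> alone, and is zero if \<open>k\<close> is not
    in \<open>S\<close>. On the columns from \<open>S\<close>, \<open>M\<close> is thus a 0-1 matrix
    with a single 1 in each row from \<open>S\<close>.\<close>
  have Mkj: "M $$ (k, j) = (if k \<in> S \<and> j = f k then 1 else 0)" if k: "k < n" and j: "j \<in> S" for k j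
  proof -
    have jn: "j < n" using j S(1) by auto
    have "(\<Sum>i\<in>S. ?c i * N i $$ (k, j)) = (\<Sum>i\<in>S. if i = k then ?c k * N k $$ (k, j) else 0)"
      using N(2)[OF _ k jn] S(1) by (intro sum.cong) auto
    also have "\<dots> = (if k \<in> S then ?c k * N k $$ (k, j) else 0)" using fin by simp
    also have "\<dots> = (if k \<in> S \<and> j = f k then 1 else 0)" using f j by auto
    finally show ?thesis using M(2)[OF k jn] by simp
  qed
  let ?X = "vec n (\<lambda>i. if i \<in> S then 1 else 0) :: 'a vec"
  have "M *\<^sub>v ?X = ?X"
  proof (rule eq_vecI)
    fix k assume "k < dim_vec ?X"
    then have k: "k < n" by simp
    have "(M *\<^sub>v ?X) $ k = (\<Sum>j<n. M $$ (k, j) * (if j \<in> S then 1 else 0))"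
      using Mc k by (simp add: scalar_prod_def lessThan_atLeast0)
    also have "\<dots> = (\<Sum>j\<in>S. M $$ (k, j))"
      using S(1) by (intro sum.mono_neutral_cong_right) auto
    also have "\<dots> = (\<Sum>j\<in>S. if j = f k then (if k \<in> S then 1 else 0) else 0)"
      using Mkj[OF k] by (intro sum.cong) auto
    also have "\<dots> = (if k \<in> S then 1 else 0)" using fin f by simp
    finally show "(M *\<^sub>v ?X) $ k = ?X $ k" using k by simp
  qed (use Mc in simp)
  moreover have "?X \<noteq> 0\<^sub>v n"
  proof
    assume X0: "?X = 0\<^sub>v n"
    obtain s where s: "s \<in> S" "s < n" using S by auto
    have "?X $ s = 1" using s by simp
    then show False using s unfolding X0 by simp
  qed
  ultimately show False using H M(1) unfolding trivial_spectrum_def by (metis vec_carrier)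
qed

section \<open>Induction for the dimension bound\<close>

theorem trivial_spectrum_dim_le:
  fixes H :: "'a::field mat set"
  assumes "trivial_spectrum n H"
  shows "mat_dim n n H \<le> n choose 2"
  using assms
proof (induction n arbitrary: H)
  case 0
  then have "mat_space 0 0 H" unfolding trivial_spectrum_iff_det by simp
  from mat_dim_le(1)[OF this] show ?case by simp
next
  case (Suc n)
  have H: "mat_space (Suc n) (Suc n) H" and det: "\<And>M. M \<in> H \<Longrightarrow> det (M - 1\<^sub>m (Suc n)) \<noteq> 0"
    using Suc.prems unfolding trivial_spectrum_iff_det by auto
  note Hc = mat_spaceD(5)[OF H]
  obtain i where i: "i < Suc n"
    and good: "\<forall>M\<in>H. (\<forall>k<Suc n. \<forall>j<Suc n. k \<noteq> i \<longrightarrow> M $$ (k, j) = 0) \<longrightarrow> M = 0\<^sub>m (Suc n) (Suc n)"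
    using trivial_spectrum_ex_good_row[OF Suc.prems] by auto
  \<comment> \<open>\<open>?f M\<close> is column \<open>i\<close> of \<open>M\<close>, kept as a
    matrix so that rank-nullity applies; \<open>?K\<close> is its kernel.\<close>
  let ?f = "select_mat (Suc n) 1 (\<lambda>k. k) (\<lambda>_. i) :: 'a mat \<Rightarrow> 'a mat"
  let ?K = "{M \<in> H. ?f M = 0\<^sub>m (Suc n) 1}"
  have lin: "mat_linear_on H (Suc n) 1 ?f"
    using select_mat_linear[OF mat_spaceD(1)[OF H]] i by simp
  have carr: "M - 1\<^sub>m (Suc n) \<in> carrier_mat (Suc n) (Suc n)" for M :: "'a mat"
    by (rule minus_carrier_mat[OF one_carrier_mat])
  \<comment> \<open>If the columns filled the whole space, some \<open>M\<close> in \<open>H\<close>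
    would have the \<open>i\<close>-th unit vector as its column \<open>i\<close>. Then column
    \<open>i\<close> of \<open>M - 1\<close> is zero, so \<open>M - 1\<close> is singular.\<close>
  have im: "mat_dim (Suc n) 1 (?f ` H) \<le> n"
  proof (rule ccontr)
    assume "\<not> ?thesis"
    then have "mat_dim (Suc n) 1 (?f ` H) = Suc n * 1"
      using mat_dim_le(1)[OF mat_rank_nullity(1)[OF H lin]] by simp
    from mat_dim_le(2)[OF mat_rank_nullity(1)[OF H lin] this]
    have "mat (Suc n) 1 (\<lambda>(k, _). if k = i then 1 else 0) \<in> ?f ` H" by simp
    then obtain M where M: "M \<in> H" "?f M = mat (Suc n) 1 (\<lambda>(k, _). if k = i then 1 else 0)"
      by auto
    have "M $$ (k, i) = (if k = i then 1 else 0)" if "k < Suc n" for k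
      using arg_cong[OF M(2), of "\<lambda>A. A $$ (k, 0)"] that by simp
    then have "det (M - 1\<^sub>m (Suc n)) = 0"
      using i Hc[OF M(1)] by (subst laplace_expansion_column[OF carr i]) (auto intro!: sum.neutral)
    then show False using det[OF M(1)] by simp
  qed
  \<comment> \<open>On \<open>?K\<close>, deleting row and column \<open>i\<close> gives the action
    on the quotient by the \<open>i\<close>-th unit vector.\<close>
  let ?g = "select_mat n n (insert_index i) (insert_index i) :: 'a mat \<Rightarrow> 'a mat"
  have delete: "mat_delete M i i = ?g M" if "M \<in> carrier_mat (Suc n) (Suc n)" for M
    using that by (intro eq_matI) (auto simp: mat_delete_def insert_index_def)
  have ins: "insert_index i k < Suc n" if "k < n" for k
    using that by (simp add: insert_index_def)
  have K: "mat_space (Suc n) (Suc n) ?K" by (rule mat_rank_nullity(2)[OF H lin])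
  have Kcol: "M $$ (k, i) = 0" if "M \<in> ?K" "k < Suc n" for M k
  proof -
    have "?f M $$ (k, 0) = 0\<^sub>m (Suc n) 1 $$ (k, 0)" using that by simp
    then show ?thesis using that by simp
  qed
  have linK: "mat_linear_on ?K n n ?g"
    using select_mat_linear[OF mat_spaceD(1)[OF K]] ins by blast
  have "mat_dim (Suc n) (Suc n) ?K = mat_dim n n (?g ` ?K)"
  \<comment> \<open>A matrix of \<open>?K\<close> killed by \<open>?g\<close> has zero column
    \<open>i\<close> and zero entries off row and column \<open>i\<close>. It is concentrated on row
    \<open>i\<close>, and the choice of \<open>i\<close> makes it zero.\<close>
  proof (rule mat_dim_inj_image[OF K linK, symmetric])
    fix M assume M: "M \<in> ?K" and g: "?g M = 0\<^sub>m n n"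
    have MH: "M \<in> H" using M by simp
    show "M = 0\<^sub>m (Suc n) (Suc n)"
    proof (rule good[rule_format, OF MH])
      fix k j assume k: "k < Suc n" "k \<noteq> i" and j: "j < Suc n"
      show "M $$ (k, j) = 0"
      proof (cases "j = i")
        case False
        obtain k' where k': "k' < n" "k = insert_index i k'"
          using insert_index_image[OF i] k by (metis DiffI atLeastLessThan_iff imageE singletonD zero_le)
        obtain j' where j': "j' < n" "j = insert_index i j'"
          using insert_index_image[OF i] j False by (metis DiffI atLeastLessThan_iff imageE singletonD zero_le)
        have "M $$ (k, j) = ?g M $$ (k', j')"
          using k' j' by simp
        then show ?thesis using g k' j' by simp
      qed (use Kcol[OF M] k in simp)
    qed
  qed
  also have "\<dots> \<le> n choose 2"
  proof (rule Suc.IH)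
    show "trivial_spectrum n (?g ` ?K)"
      unfolding trivial_spectrum_iff_det
    proof (intro conjI ballI mat_rank_nullity(1)[OF K linK])
      fix N assume "N \<in> ?g ` ?K"
      then obtain M where M: "M \<in> ?K" "N = ?g M" by blast
      have Mc: "M \<in> carrier_mat (Suc n) (Suc n)" using M Hc by simp
      \<comment> \<open>Column \<open>i\<close> of \<open>M\<close> is zero, so column
        \<open>i\<close> of \<open>M - 1\<close> is minus a unit vector, and the expansion reduces
        to the single term \<open>- det (N - 1\<^sub>m n)\<close>.\<close>
      have "det (M - 1\<^sub>m (Suc n)) =
        (\<Sum>k<Suc n. (M - 1\<^sub>m (Suc n)) $$ (k, i) * cofactor (M - 1\<^sub>m (Suc n)) k i)"
        by (rule laplace_expansion_column[OF carr i])
      also have "\<dots> = (\<Sum>k<Suc n. if k = i then - cofactor (M - 1\<^sub>m (Suc n)) i i else 0)"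
        using Kcol[OF M(1)] Mc i by (intro sum.cong) auto
      also have "\<dots> = - det (mat_delete (M - 1\<^sub>m (Suc n)) i i)"
        using i by (simp add: cofactor_def power_add[symmetric])
      also have "mat_delete (M - 1\<^sub>m (Suc n)) i i = N - 1\<^sub>m n"
        using Mc ins unfolding M(2) delete[OF carr]
        by (intro eq_matI) (auto simp: insert_index_def)
      finally show "det (N - 1\<^sub>m n) \<noteq> 0" using det[of M] M(1) by auto
    qed
  qed
  finally have "mat_dim (Suc n) (Suc n) ?K \<le> n choose 2" .
  moreover have "Suc n choose 2 = n + (n choose 2)" by (simp add: numeral_2_eq_2)
  ultimately show ?case using mat_rank_nullity(3)[OF H lin] im by simp
qed

subsection \<open>Similarity and block form\<close>

text \<open>The inverse is kept as an explicit second matrix, matching the two witnesses in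
  \<open>similar_mat_sets\<close>.\<close>

definition inverse_mats :: "nat \<Rightarrow> 'a::field mat \<Rightarrow> 'a mat \<Rightarrow> bool" where
  "inverse_mats n R S \<longleftrightarrow>
     R \<in> carrier_mat n n \<and> S \<in> carrier_mat n n \<and> R * S = 1\<^sub>m n \<and> S * R = 1\<^sub>m n"

lemma similar_mat_sets_iff:
  "similar_mat_sets n V W \<longleftrightarrow> (\<exists>R S. inverse_mats n R S \<and> W = (\<lambda>M. R * M * S) ` V)"
  unfolding similar_mat_sets_def inverse_mats_def inverts_mat_def by auto

lemma inverse_mats_one: "inverse_mats n (1\<^sub>m n) (1\<^sub>m n)"
  unfolding inverse_mats_def by simp

text \<open>Used to compose conjugations, to undo one, and, with the identity for \<open>M\<close>,
  to invert products.\<close>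

lemma mult_mult_assoc:
  fixes R1 :: "'a::field mat"
  assumes "R1 \<in> carrier_mat n n" "S1 \<in> carrier_mat n n" "R2 \<in> carrier_mat n n"
    "S2 \<in> carrier_mat n n" "M \<in> carrier_mat n n"
  shows "R2 * (R1 * M * S1) * S2 = (R2 * R1) * M * (S1 * S2)"
  using assms by (simp add: assoc_mult_mat[of _ n n _ n _ n] mult_carrier_mat[of _ n n _ n])

lemma inverse_mats_mult:
  fixes R1 :: "'a::field mat"
  assumes 1: "inverse_mats n R1 S1" and 2: "inverse_mats n R2 S2"
  shows "inverse_mats n (R2 * R1) (S1 * S2)"
proof -
  note c = 1[unfolded inverse_mats_def] 2[unfolded inverse_mats_def]
  have "(R2 * R1) * (S1 * S2) = 1\<^sub>m n"
    using mult_mult_assoc[of R1 n S1 R2 S2 "1\<^sub>m n"] c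
    by (simp add: right_mult_one_mat[of _ n n] mult_carrier_mat[of _ n n _ n])
  moreover have "(S1 * S2) * (R2 * R1) = 1\<^sub>m n"
    using mult_mult_assoc[of S2 n R2 S1 R1 "1\<^sub>m n"] c
    by (simp add: right_mult_one_mat[of _ n n] mult_carrier_mat[of _ n n _ n])
  ultimately show ?thesis using c unfolding inverse_mats_def by auto
qed

text \<open>Block diagonal conjugation preserves the triangular form and acts on each diagonal block
  separately, so either block can be refined while the other stays fixed.\<close>

lemma conj_four_block:
  fixes A :: "'a::field mat"
  assumes "Q1 \<in> carrier_mat m m" "T1 \<in> carrier_mat m m" "Q2 \<in> carrier_mat p p" "T2 \<in> carrier_mat p p"
    "A \<in> carrier_mat m m" "B \<in> carrier_mat m p" "C \<in> carrier_mat p p"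
  shows "four_block_mat Q1 (0\<^sub>m m p) (0\<^sub>m p m) Q2 * four_block_mat A B (0\<^sub>m p m) C
      * four_block_mat T1 (0\<^sub>m m p) (0\<^sub>m p m) T2
    = four_block_mat (Q1 * A * T1) (Q1 * B * T2) (0\<^sub>m p m) (Q2 * C * T2)"
proof -
  have "four_block_mat Q1 (0\<^sub>m m p) (0\<^sub>m p m) Q2 * four_block_mat A B (0\<^sub>m p m) C
    = four_block_mat (Q1 * A) (Q1 * B) (0\<^sub>m p m) (Q2 * C)"
    using assms by (subst mult_four_block_mat[of _ m m _ p _ p _ _ m _ p]) auto
  moreover have "four_block_mat (Q1 * A) (Q1 * B) (0\<^sub>m p m) (Q2 * C)
      * four_block_mat T1 (0\<^sub>m m p) (0\<^sub>m p m) T2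
    = four_block_mat (Q1 * A * T1) (Q1 * B * T2) (0\<^sub>m p m) (Q2 * C * T2)"
    using assms by (subst mult_four_block_mat[of _ m m _ p _ p _ _ m _ p]) auto
  ultimately show ?thesis by simp
qed

lemma inverse_mats_diag:
  fixes Q1 :: "'a::field mat"
  assumes "inverse_mats m Q1 T1" "inverse_mats p Q2 T2"
  shows "inverse_mats (m + p) (four_block_mat Q1 (0\<^sub>m m p) (0\<^sub>m p m) Q2)
    (four_block_mat T1 (0\<^sub>m m p) (0\<^sub>m p m) T2)"
proof -
  note c = assms[unfolded inverse_mats_def]
  have "four_block_mat Q1 (0\<^sub>m m p) (0\<^sub>m p m) Q2 * four_block_mat T1 (0\<^sub>m m p) (0\<^sub>m p m) T2 = 1\<^sub>m (m + p)"
    using c by (subst mult_four_block_mat[of _ m m _ p _ p _ _ m _ p]) auto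
  moreover have "four_block_mat T1 (0\<^sub>m m p) (0\<^sub>m p m) T2 * four_block_mat Q1 (0\<^sub>m m p) (0\<^sub>m p m) Q2 = 1\<^sub>m (m + p)"
    using c by (subst mult_four_block_mat[of _ m m _ p _ p _ _ m _ p]) auto
  ultimately show ?thesis using c unfolding inverse_mats_def by auto
qed

text \<open>Conjugation is linear and injective, and \<open>R * M * S - 1\<close> equals
  \<open>R * (M - 1) * S\<close>, whose determinant is that of \<open>M - 1\<close> because
  \<open>det R * det S = 1\<close>.\<close>

lemma maximal_trivial_spectrum_conj:
  fixes H :: "'a::field mat set"
  assumes H: "maximal_trivial_spectrum n H" and RS: "inverse_mats n R S"
  shows "maximal_trivial_spectrum n ((\<lambda>M. R * M * S) ` H)"
proof -
  note c = RS[unfolded inverse_mats_def]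
  have sp: "mat_space n n H" and det: "\<And>M. M \<in> H \<Longrightarrow> det (M - 1\<^sub>m n) \<noteq> 0"
    and dim: "mat_dim n n H = n choose 2"
    using H unfolding maximal_trivial_spectrum_iff trivial_spectrum_iff_det by auto
  have Hc: "M \<in> carrier_mat n n" if "M \<in> H" for M using mat_spaceD(5)[OF sp that] .
  have "R * (M + N) * S = R * M * S + R * N * S" if "M \<in> H" "N \<in> H" for M N
    using c Hc[OF that(1)] Hc[OF that(2)] add_mult_distrib_mat[of "R * M" n n "R * N" S n]
    by (simp add: mult_add_distrib_mat[of _ n n] mult_carrier_mat[of _ n n _ n])
  moreover have "R * (k \<cdot>\<^sub>m M) * S = k \<cdot>\<^sub>m (R * M * S)" if "M \<in> H" for k M
    using c Hc[OF that] mult_smult_assoc_mat[of "R * M" n n S n k]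
    by (simp add: mult_smult_distrib[of _ n n _ n] mult_carrier_mat[of _ n n _ n])
  moreover have "R * M * S \<in> carrier_mat n n" for M using c by auto
  ultimately have lin: "mat_linear_on H n n (\<lambda>M. R * M * S)" unfolding mat_linear_on_def by auto
  have undo: "S * (R * M * S) * R = M" if "M \<in> carrier_mat n n" for M
    using c that by (subst mult_mult_assoc[of _ n]) auto
  have "mat_dim n n ((\<lambda>M. R * M * S) ` H) = mat_dim n n H"
  proof (rule mat_dim_inj_image[OF sp lin])
    fix M assume M: "M \<in> H" "R * M * S = 0\<^sub>m n n"
    have "M = S * 0\<^sub>m n n * R" using undo[OF Hc[OF M(1)]] unfolding M(2) by simp
    then show "M = 0\<^sub>m n n"
      using c by (simp add: right_mult_zero_mat[of _ n n] left_mult_zero_mat[of _ n n])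
  qed
  moreover have "det (R * M * S - 1\<^sub>m n) \<noteq> 0" if "M \<in> H" for M
  proof -
    have "R * (M - 1\<^sub>m n) * S = R * M * S - 1\<^sub>m n"
      using c Hc[OF that] minus_mult_distrib_mat[of "R * M" n n R S n]
      by (simp add: mult_minus_distrib_mat[of _ n n] right_mult_one_mat[of _ n n] mult_carrier_mat[of _ n n _ n])
    then have "det (R * M * S - 1\<^sub>m n) = det R * det (M - 1\<^sub>m n) * det S"
      using c Hc[OF that] det_mult[of "R * (M - 1\<^sub>m n)" n S] det_mult[of R n "M - 1\<^sub>m n"]
      by (metis minus_carrier_mat mult_carrier_mat one_carrier_mat)
    moreover have "det R * det S = 1" using c det_mult[of R n S] by simp
    ultimately show ?thesis using det[OF that] by auto
  qed
  ultimately show ?thesis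
    using mat_rank_nullity(1)[OF sp lin] dim
    unfolding maximal_trivial_spectrum_iff trivial_spectrum_iff_det by auto
qed

section \<open>From a stable subspace to a block form\<close>

text \<open>The columns of \<open>S\<close> are a basis of \<open>U\<close> followed by an extension
  to a basis of the whole space, and \<open>R\<close> is the inverse of \<open>S\<close>. Stability
  keeps the images of the first \<open>m\<close> columns in \<open>U\<close>, where the coordinates
  from \<open>m\<close> on vanish.\<close>

lemma stable_subspace_block_form:
  fixes H :: "'a::field mat set"
  assumes U: "subspace class_ring U (module_vec TYPE('a) n)"
    and proper: "U \<noteq> {0\<^sub>v n}" "U \<noteq> carrier_vec n"
    and H: "H \<subseteq> carrier_mat n n" and stable: "\<And>M X. M \<in> H \<Longrightarrow> X \<in> U \<Longrightarrow> M *\<^sub>v X \<in> U"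
  obtains m R S where "0 < m" "m < n" "inverse_mats n R S"
    "\<And>M i j. M \<in> H \<Longrightarrow> m \<le> i \<Longrightarrow> i < n \<Longrightarrow> j < m \<Longrightarrow> (R * M * S) $$ (i, j) = 0"
proof -
  interpret vec_space "TYPE('a)" n .
  obtain B where B: "finite B" "B \<subseteq> U" "lin_indpt B" "span B = U"
    "card B = vectorspace.dim class_ring (vs U)"
    using subspace_basis_exists[OF fin_dim U] .
  have UV: "U \<subseteq> carrier_vec n"
    using submodule.subset[OF is_module[OF U]] by (simp add: module_vec_simps)
  define m where "m = card B"
  have "m \<noteq> 0" using B proper(1) span_empty unfolding m_def by auto
  have "m \<noteq> n" using B(5) subspace_dim_eq_imp_eq[OF fin_dim U] dim_is_n proper(2) unfolding m_def by auto
  let ?E = "set (unit_vecs n) :: 'a vec set"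
  have E: "?E \<subseteq> carrier_vec n" "span ?E = carrier_vec n" "card ?E = n"
    using span_unit_vecs_is_carrier distinct_card[OF unit_vecs_distinct] by (auto simp: unit_vecs_def)
  have BE: "B \<subseteq> span ?E" using B(2) UV E(2) by auto
  \<comment> \<open>Steinitz exchange against the unit vectors extends \<open>B\<close> by at most
    \<open>n - m\<close> vectors.\<close>
  obtain C where C: "finite C" "C \<subseteq> carrier_vec n" "C \<inter> B = {}"
    "int (card C) \<le> int (card ?E) - int (card B)" "span (B \<union> C) = span ?E"
    using replacement[OF B(1) _ _ B(3) BE] E(1) by auto
  obtain bs where bs: "set bs = B" "distinct bs" using finite_distinct_list[OF B(1)] by auto
  obtain cs where cs: "set cs = C" "distinct cs" using finite_distinct_list[OF C(1)] by auto
  have lbs: "length bs = m" using distinct_card[OF bs(2)] bs(1) m_def by simp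
  have lcs: "length cs = card C" using distinct_card[OF cs(2)] cs(1) by simp
  \<comment> \<open>A spanning set has at least \<open>n\<close> elements, so exactly
    \<open>n - m\<close> vectors were added and \<open>S\<close> is square.\<close>
  have "n \<le> card (B \<union> C)"
    using gen_ge_dim[of "B \<union> C"] B C UV E dim_is_n by auto
  also have "\<dots> \<le> m + card C" unfolding m_def by (rule card_Un_le)
  finally have len: "length (bs @ cs) = n" "m \<le> n" using C(4) E(3) lbs lcs unfolding m_def by auto
  define S where "S = mat_of_cols n (bs @ cs)"
  have Sc: "S \<in> carrier_mat n n" unfolding S_def using len by auto
  have sub: "set (bs @ cs) \<subseteq> carrier_vec n" using bs cs B(2) UV C(2) by auto
  have "cols S = bs @ cs" unfolding S_def using sub by (rule cols_mat_of_cols)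
  then have "col_space S = carrier_vec n" unfolding col_space_def using bs cs C(5) E(2) by simp
  then have "\<exists>w\<in>carrier_vec n. S *\<^sub>v w = unit_vec n i" for i
  proof -
    have "unit_vec n i \<in> col_space S" using \<open>col_space S = carrier_vec n\<close> by simp
    then show ?thesis using Sc unfolding col_space_eq[OF Sc] by auto
  qed
  \<comment> \<open>The columns of \<open>S\<close> span everything, so each unit vector is some
    \<open>S *\<^sub>v w i\<close>; the \<open>w i\<close> are the columns of a right inverse, which
    is two-sided since \<open>S\<close> is square.\<close>
  then obtain w where w: "\<And>i. w i \<in> carrier_vec n" "\<And>i. S *\<^sub>v w i = unit_vec n i" by metis
  define R where "R = mat_of_cols n (map w [0..<n])"
  have Rc: "R \<in> carrier_mat n n" unfolding R_def by auto
  have colR: "col R j = w j" if "j < n" for j unfolding R_def using that w(1) by simp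
  have SR: "S * R = 1\<^sub>m n"
  proof (rule mat_col_eqI)
    fix j assume "j < dim_col (1\<^sub>m n :: 'a mat)"
    then have j: "j < n" by simp
    show "col (S * R) j = col (1\<^sub>m n) j"
      unfolding col_mult2[OF Sc Rc j] colR[OF j] w(2) col_one[OF j] ..
  qed (use Sc Rc in auto)
  have RS: "R * S = 1\<^sub>m n" by (rule mat_mult_left_right_inverse[OF Sc Rc SR])
  have colS: "col S j = bs ! j" if "j < m" for j
    unfolding S_def using that len lbs sub by (subst col_mat_of_cols) (auto simp: nth_append)
  \<comment> \<open>The vectors whose coordinates in the new basis vanish from \<open>m\<close> on.
    This is a subspace containing \<open>B\<close>, hence it contains \<open>U\<close>.\<close>
  let ?N = "{u \<in> carrier_vec n. \<forall>i. m \<le> i \<longrightarrow> i < n \<longrightarrow> (R *\<^sub>v u) $ i = 0}"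
  have "submodule class_ring ?N V"
    using vec_module Rc unfolding submodule_def
    by (auto simp: module_vec_simps class_ring_simps scalar_prod_add_distrib[of _ n] row_carrier_vec)
  moreover have "B \<subseteq> ?N"
  proof
    fix b assume b: "b \<in> B"
    then obtain j where j: "j < m" "b = bs ! j" using bs(1) lbs by (metis in_set_conv_nth)
    have jn: "j < n" using j len by simp
    have "R *\<^sub>v b = unit_vec n j"
      using col_mult2[OF Rc Sc jn] colS[OF j(1)] jn unfolding RS j(2) by simp
    then show "b \<in> ?N" using b B(2) UV j by auto
  qed
  ultimately have UN: "U \<subseteq> ?N" using span_is_subset[of B ?N] B(4) by simp
  show thesis
  proof (rule that[of m R S])
    show "0 < m" "m < n" using \<open>m \<noteq> 0\<close> \<open>m \<noteq> n\<close> len by auto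
    show "inverse_mats n R S" unfolding inverse_mats_def using Rc Sc RS SR by simp
    fix M i j assume M: "M \<in> H" and i: "m \<le> i" "i < n" and j: "j < m"
    have Mc: "M \<in> carrier_mat n n" using M H by auto
    have jn: "j < n" using j len by simp
    have "(R * M * S) $$ (i, j) = col (R * (M * S)) j $ i"
      using Rc Sc Mc i jn by (simp add: assoc_mult_mat[of _ n n _ n _ n])
    also have "col (R * (M * S)) j = R *\<^sub>v (M *\<^sub>v bs ! j)"
      unfolding col_mult2[OF Rc mult_carrier_mat[OF Mc Sc] jn] col_mult2[OF Mc Sc jn] colS[OF j] ..
    \<comment> \<open>This fact and the next lead to the last link of the calculation:
      \<open>M\<close> keeps \<open>bs ! j\<close> in \<open>U\<close>, and \<open>R\<close> sends
      vectors of \<open>U\<close> to vectors with zero coordinate \<open>i\<close>.\<close>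
    also have "bs ! j \<in> U" using B(2) bs(1) lbs j by auto
    then have "M *\<^sub>v bs ! j \<in> ?N" using stable[OF M] UN by blast
    then have "(R *\<^sub>v (M *\<^sub>v bs ! j)) $ i = 0" using i by simp
    finally show "(R * M * S) $$ (i, j) = 0" .
  qed
qed

section \<open>Maximal spaces in block triangular form\<close>

abbreviation upper_left :: "nat \<Rightarrow> 'a mat \<Rightarrow> 'a mat" where
  "upper_left m \<equiv> select_mat m m (\<lambda>i. i) (\<lambda>j. j)"

abbreviation upper_right :: "nat \<Rightarrow> nat \<Rightarrow> 'a mat \<Rightarrow> 'a mat" where
  "upper_right m p \<equiv> select_mat m p (\<lambda>i. i) (\<lambda>j. j + m)"

abbreviation lower_right :: "nat \<Rightarrow> nat \<Rightarrow> 'a mat \<Rightarrow> 'a mat" where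
  "lower_right m p \<equiv> select_mat p p (\<lambda>i. i + m) (\<lambda>j. j + m)"

lemma block_triangular_decomp:
  assumes "M \<in> carrier_mat (m + p) (m + p)"
    and "\<And>i j. m \<le> i \<Longrightarrow> i < m + p \<Longrightarrow> j < m \<Longrightarrow> M $$ (i, j) = 0"
  shows "M = four_block_mat (upper_left m M) (upper_right m p M) (0\<^sub>m p m) (lower_right m p M)"
  using assms by (intro eq_matI) auto

text \<open>Two indices out of \<open>m + p\<close> lie both in the first group, both in the second,
  or one in each. The mixed term is the dimension of the upper right block, which makes the count
  for block triangular spaces sharp.\<close>

lemma choose_two_add: "(m + p) choose 2 = (m choose 2) + (p choose 2) + m * p"
  by (induction p) (auto simp: numeral_2_eq_2)

text \<open>\<open>det (M - 1)\<close> is the product of the determinants for the diagonal blocks,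
  so both families of blocks have trivial spectrum and obey the bound. Applying rank-nullity block
  by block bounds the dimension of \<open>H\<close> by exactly its actual value, so each estimate is
  an equality.\<close>

lemma maximal_trivial_spectrum_block_triangular:
  fixes H :: "'a::field mat set"
  assumes H: "maximal_trivial_spectrum (m + p) H"
    and zero: "\<And>M i j. M \<in> H \<Longrightarrow> m \<le> i \<Longrightarrow> i < m + p \<Longrightarrow> j < m \<Longrightarrow> M $$ (i, j) = 0"
  shows "maximal_trivial_spectrum m (upper_left m ` H)"
    "maximal_trivial_spectrum p (lower_right m p ` H)"
    "H = mat_join m p (upper_left m ` H) (lower_right m p ` H)"
proof -
  let ?n = "m + p" and ?ul = "upper_left m :: 'a mat \<Rightarrow> 'a mat"
    and ?ur = "upper_right m p :: 'a mat \<Rightarrow> 'a mat" and ?lr = "lower_right m p :: 'a mat \<Rightarrow> 'a mat"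
  have sp: "mat_space ?n ?n H" and det: "\<And>M. M \<in> H \<Longrightarrow> det (M - 1\<^sub>m ?n) \<noteq> 0"
    and dim: "mat_dim ?n ?n H = ?n choose 2"
    using H unfolding maximal_trivial_spectrum_iff trivial_spectrum_iff_det by auto
  note Hc = mat_spaceD(5)[OF sp]
  have decomp: "M = four_block_mat (?ul M) (?ur M) (0\<^sub>m p m) (?lr M)" if "M \<in> H" for M
    using block_triangular_decomp[OF Hc[OF that] zero[OF that]] .
  have lin: "mat_linear_on G m m ?ul" "mat_linear_on G m p ?ur" "mat_linear_on G p p ?lr"
    if "mat_space ?n ?n G" for G
    using mat_spaceD(1)[OF that] by (auto intro!: select_mat_linear)
  have "det (?ul M - 1\<^sub>m m) \<noteq> 0 \<and> det (?lr M - 1\<^sub>m p) \<noteq> 0" if "M \<in> H" for M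
  proof -
    have "M - 1\<^sub>m ?n = four_block_mat (?ul M - 1\<^sub>m m) (?ur M) (0\<^sub>m p m) (?lr M - 1\<^sub>m p)"
      using Hc[OF that] zero[OF that] by (intro eq_matI) auto
    then have "det (M - 1\<^sub>m ?n) = det (?ul M - 1\<^sub>m m) * det (?lr M - 1\<^sub>m p)"
      using det_four_block_mat_lower_left_zero[of "?ul M - 1\<^sub>m m" m "?ur M" p "0\<^sub>m p m" "?lr M - 1\<^sub>m p"]
      by (simp add: minus_carrier_mat)
    then show ?thesis using det[OF that] by auto
  qed
  then have triv: "trivial_spectrum m (?ul ` H)" "trivial_spectrum p (?lr ` H)"
    using mat_rank_nullity(1)[OF sp lin(1)[OF sp]] mat_rank_nullity(1)[OF sp lin(3)[OF sp]]
    unfolding trivial_spectrum_iff_det by auto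
  have spV: "mat_space m m (?ul ` H)" and spW: "mat_space p p (?lr ` H)"
    using triv unfolding trivial_spectrum_iff_det by auto
  \<comment> \<open>The filtration of \<open>H\<close>: upper left block zero, then lower right
    block zero as well. On \<open>H2\<close> the upper right block determines the matrix.\<close>
  define H1 where "H1 = {M \<in> H. ?ul M = 0\<^sub>m m m}"
  define H2 where "H2 = {M \<in> H1. ?lr M = 0\<^sub>m p p}"
  note rn1 = mat_rank_nullity[OF sp lin(1)[OF sp], folded H1_def]
  note rn2 = mat_rank_nullity[OF rn1(2) lin(3)[OF rn1(2)], folded H2_def]
  have "mat_dim m p (?ur ` H2) = mat_dim ?n ?n H2"
  proof (rule mat_dim_inj_image[OF rn2(2) lin(2)[OF rn2(2)]])
    fix M assume M: "M \<in> H2" "?ur M = 0\<^sub>m m p"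
    then have "M \<in> H" "?ul M = 0\<^sub>m m m" "?lr M = 0\<^sub>m p p" unfolding H1_def H2_def by auto
    then show "M = 0\<^sub>m ?n ?n" using decomp[of M] M(2) by simp
  qed
  moreover have spB: "mat_space m p (?ur ` H2)" by (rule mat_rank_nullity(1)[OF rn2(2) lin(2)[OF rn2(2)]])
  ultimately have B: "mat_dim ?n ?n H2 \<le> m * p" "mat_dim ?n ?n H2 = m * p \<Longrightarrow> ?ur ` H2 = carrier_mat m p"
    using mat_dim_le[OF spB] by auto
  have sub: "?lr ` H1 \<subseteq> ?lr ` H" unfolding H1_def by auto
  note le = trivial_spectrum_dim_le[OF triv(1)] trivial_spectrum_dim_le[OF triv(2)]
    mat_dim_subspace[OF rn2(1) spW sub]
  \<comment> \<open>The upper bounds add up to \<open>(m + p) choose 2\<close>, the dimension of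
    \<open>H\<close>, so none of them is strict.\<close>
  from le B(1) rn1(3) rn2(3) dim choose_two_add[of m p]
  have eqs: "mat_dim m m (?ul ` H) = m choose 2" "mat_dim p p (?lr ` H) = p choose 2"
    "mat_dim p p (?lr ` H1) = mat_dim p p (?lr ` H)" "mat_dim ?n ?n H2 = m * p"
    by linarith+
  show "maximal_trivial_spectrum m (?ul ` H)" "maximal_trivial_spectrum p (?lr ` H)"
    unfolding maximal_trivial_spectrum_iff using triv eqs by auto
  have lrH1: "?lr ` H1 = ?lr ` H" using le(4) eqs(3) by simp
  have urH2: "?ur ` H2 = carrier_mat m p" using B(2) eqs(4) by simp
  show "H = mat_join m p (?ul ` H) (?lr ` H)"
  proof (intro equalityI subsetI)
    fix M assume "M \<in> H"
    then show "M \<in> mat_join m p (?ul ` H) (?lr ` H)"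
      using decomp[of M] unfolding mat_join_def by fastforce
  next
    fix X assume "X \<in> mat_join m p (?ul ` H) (?lr ` H)"
    then obtain M B L where X: "X = four_block_mat (?ul M) B (0\<^sub>m p m) (?lr L)"
      and M: "M \<in> H" and Bc: "B \<in> carrier_mat m p" and L: "L \<in> H"
      unfolding mat_join_def by auto
    \<comment> \<open>\<open>X\<close> is assembled in three stages: \<open>M\<close> provides the
      upper left block, \<open>N\<close> from \<open>H1\<close> corrects the lower right block, and
      \<open>P\<close> from \<open>H2\<close> corrects the upper right block. Each correction leaves
      the earlier blocks untouched.\<close>
    have "?lr (L - M) \<in> ?lr ` H1" using lrH1 mat_space_diff[OF sp L M] by simp
    then obtain N where N: "N \<in> H1" "?lr (L - M) = ?lr N" by auto
    have NH: "N \<in> H" "?ul N = 0\<^sub>m m m" using N(1) unfolding H1_def by auto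
    have "B - ?ur M - ?ur N \<in> ?ur ` H2" unfolding urH2 by (simp add: minus_carrier_mat)
    then obtain P where P: "P \<in> H2" "B - ?ur M - ?ur N = ?ur P" by auto
    have PH: "P \<in> H" "?ul P = 0\<^sub>m m m" "?lr P = 0\<^sub>m p p" using P(1) unfolding H1_def H2_def by auto
    have "X = M + N + P"
    proof (rule eq_matI)
      fix i j assume "i < dim_row (M + N + P)" "j < dim_col (M + N + P)"
      then have ij: "i < ?n" "j < ?n" using Hc[OF PH(1)] by auto
      note c = Hc[OF M] Hc[OF NH(1)] Hc[OF PH(1)] Hc[OF L]
      consider "i < m" "j < m" | "i < m" "m \<le> j" | "m \<le> i" "j < m" | "m \<le> i" "m \<le> j" by linarith
      then show "X $$ (i, j) = (M + N + P) $$ (i, j)"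
      proof cases
        case 1
        then show ?thesis
          using c ij arg_cong[OF NH(2), of "\<lambda>A. A $$ (i, j)"] arg_cong[OF PH(2), of "\<lambda>A. A $$ (i, j)"]
          unfolding X by simp
      next
        case 2
        then show ?thesis
          using c ij Bc arg_cong[OF P(2), of "\<lambda>A. A $$ (i, j - m)"] unfolding X
          by (simp add: algebra_simps)
      next
        case 3
        then show ?thesis using c ij zero[OF M] zero[OF NH(1)] zero[OF PH(1)] unfolding X by simp
      next
        case 4
        then show ?thesis
          using c ij arg_cong[OF N(2), of "\<lambda>A. A $$ (i - m, j - m)"]
            arg_cong[OF PH(3), of "\<lambda>A. A $$ (i - m, j - m)"]
          unfolding X by (simp add: algebra_simps)
      qed
    qed (use Hc[OF PH(1)] X in auto)
    then show "X \<in> H" using mat_spaceD(3)[OF sp] M NH(1) PH(1) by simp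
  qed
qed

section \<open>Joins and their conjugates\<close>

text \<open>\<open>mat_joins\<close> treats one-element lists separately. The recursion holds there
  too, because joining with the 0 by 0 matrix appends no rows or columns.\<close>

lemma mat_joins_Cons:
  assumes "V \<subseteq> carrier_mat m m"
  shows "mat_joins ((m, V) # Vs) = mat_join m (sum_list (map fst Vs)) V (mat_joins Vs)"
proof (cases Vs)
  case Nil
  have eq: "four_block_mat A B (0\<^sub>m 0 m) C = A"
    if "A \<in> V" "B \<in> carrier_mat m 0" "C \<in> carrier_mat 0 0" for A B C :: "'a mat"
    using that assms by (intro eq_matI) auto
  have "mat_join m 0 V (carrier_mat 0 0) = V"
  proof (intro equalityI subsetI)
    fix A assume A: "A \<in> V"
    then have "A = four_block_mat A (0\<^sub>m m 0) (0\<^sub>m 0 m) (0\<^sub>m 0 0)" by (simp add: eq)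
    then show "A \<in> mat_join m 0 V (carrier_mat 0 0)" 
      using A zero_carrier_mat unfolding mat_join_def by blast
  qed (auto simp: mat_join_def eq)
  then show ?thesis using Nil by simp
qed simp

text \<open>The upper right block \<open>B\<close> becomes \<open>B * T\<close>; as \<open>T\<close>
  is invertible, this still ranges over all \<open>m\<close> by \<open>p\<close> matrices.\<close>

lemma mat_join_conj:
  fixes V :: "'a::field mat set"
  assumes V: "V \<subseteq> carrier_mat m m" and W: "W \<subseteq> carrier_mat p p" and QT: "inverse_mats p Q T"
  shows "(\<lambda>M. four_block_mat (1\<^sub>m m) (0\<^sub>m m p) (0\<^sub>m p m) Q * M *
      four_block_mat (1\<^sub>m m) (0\<^sub>m m p) (0\<^sub>m p m) T) ` mat_join m p V W
    = mat_join m p V ((\<lambda>M. Q * M * T) ` W)"  (is "?f ` _ = _")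
proof -
  note c = QT[unfolded inverse_mats_def]
  have f: "?f (four_block_mat A B (0\<^sub>m p m) C) = four_block_mat A (B * T) (0\<^sub>m p m) (Q * C * T)"
    if "A \<in> V" "B \<in> carrier_mat m p" "C \<in> W" for A B C
  proof -
    have "A \<in> carrier_mat m m" "C \<in> carrier_mat p p" using that V W by auto
    then show ?thesis using that(2) c by (subst conj_four_block) auto
  qed
  show ?thesis
  proof (intro equalityI subsetI)
    fix X assume "X \<in> ?f ` mat_join m p V W"
    then obtain A B C where "A \<in> V" "B \<in> carrier_mat m p" "C \<in> W"
      "X = four_block_mat A (B * T) (0\<^sub>m p m) (Q * C * T)"
      unfolding mat_join_def using f by auto
    moreover have "B * T \<in> carrier_mat m p" using calculation c by auto
    ultimately show "X \<in> mat_join m p V ((\<lambda>M. Q * M * T) ` W)" unfolding mat_join_def by blast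
  next
    fix X assume "X \<in> mat_join m p V ((\<lambda>M. Q * M * T) ` W)"
    then obtain A B C where X: "A \<in> V" "B \<in> carrier_mat m p" "C \<in> W"
      "X = four_block_mat A B (0\<^sub>m p m) (Q * C * T)"
      unfolding mat_join_def by auto
    \<comment> \<open>\<open>B * Q\<close> is the preimage of \<open>B\<close>, because
      \<open>Q * T\<close> is the identity.\<close>
    have BQ: "B * Q \<in> carrier_mat m p" using X c by auto
    have "B * Q * T = B" using X(2) c by (simp add: assoc_mult_mat[of _ m p _ p _ p])
    then have "X = ?f (four_block_mat A (B * Q) (0\<^sub>m p m) C)" using f[OF X(1) BQ X(3)] X(4) by simp
    then show "X \<in> ?f ` mat_join m p V W" using X BQ unfolding mat_join_def by blast
  qed
qed

section \<open>Decomposition into irreducible spaces\<close>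

theorem proposition2:
  fixes H :: "'a::field mat set" and n :: nat
  assumes "maximal_trivial_spectrum n H"
  shows "\<exists>Vs :: (nat \<times> 'a mat set) list.
      (\<forall>(m, V)\<in>set Vs. m > 0 \<and> irreducible_maximal_trivial_spectrum m V) \<and>
      sum_list (map fst Vs) = n \<and>
      similar_mat_sets n H (mat_joins Vs)"
  using assms
proof (induction n arbitrary: H rule: less_induct)
  case (less n)
  have sp: "mat_space n n H"
    using less.prems unfolding maximal_trivial_spectrum_iff trivial_spectrum_iff_det by simp
  note Hc = mat_spaceD(5)[OF sp]
  show ?case
  proof (cases "n = 0")
    case True
    \<comment> \<open>In size 0 the only subspace is the full one, which is the empty join.\<close>
    have "H = carrier_mat 0 0" using mat_dim_le[OF sp] True by simp
    moreover have "(\<lambda>M. 1\<^sub>m 0 * M * 1\<^sub>m 0) ` carrier_mat 0 0 = (carrier_mat 0 0 :: 'a mat set)"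
      by (auto simp: image_iff)
    ultimately have "similar_mat_sets n H (mat_joins [])"
      unfolding similar_mat_sets_iff using inverse_mats_one[of 0] True by fastforce
    then show ?thesis using True by (intro exI[of _ "[]"]) simp
  next
    case False
    let ?P = "\<lambda>m. 0 < m \<and> m \<le> n \<and> (\<exists>R S. inverse_mats n R S \<and>
      (\<forall>M\<in>H. \<forall>i j. m \<le> i \<longrightarrow> i < n \<longrightarrow> j < m \<longrightarrow> (R * M * S) $$ (i, j) = 0))"
    \<comment> \<open>For \<open>m = n\<close> there are no rows to annihilate, so the identity
      serves as \<open>R\<close> and \<open>S\<close>.\<close>
    have "?P n" using False inverse_mats_one[of n] by auto
    define m where "m = (LEAST m. ?P m)"
    have "?P m" unfolding m_def by (rule LeastI[of ?P, OF \<open>?P n\<close>])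
    then obtain R S where m: "0 < m" "m \<le> n" and RS: "inverse_mats n R S"
      and zero: "\<And>M i j. M \<in> H \<Longrightarrow> m \<le> i \<Longrightarrow> i < n \<Longrightarrow> j < m \<Longrightarrow> (R * M * S) $$ (i, j) = 0"
      by blast
    have least: "\<not> ?P k" if "k < m" for k using not_less_Least[of k ?P] that unfolding m_def by blast
    note RSc = RS[unfolded inverse_mats_def]
    define p where "p = n - m"
    have n: "n = m + p" using m p_def by simp
    define G where "G = (\<lambda>M. R * M * S) ` H"
    have G: "maximal_trivial_spectrum (m + p) G"
      using maximal_trivial_spectrum_conj[OF less.prems RS] unfolding G_def n by simp
    have zeroG: "M $$ (i, j) = 0" if "M \<in> G" "m \<le> i" "i < m + p" "j < m" for M i j
      using that zero unfolding G_def n by auto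
    note split = maximal_trivial_spectrum_block_triangular[OF G zeroG]
    define V where "V = upper_left m ` G"
    define W where "W = lower_right m p ` G"
    have Vc: "V \<subseteq> carrier_mat m m" unfolding V_def by auto
    have Wc: "W \<subseteq> carrier_mat p p" unfolding W_def by auto
    have join: "G = mat_join m p V W" unfolding V_def W_def using split(3) by simp
    have irr: "irreducible_maximal_trivial_spectrum m V"
      unfolding irreducible_maximal_trivial_spectrum_def
    proof (intro conjI allI impI)
      show "maximal_trivial_spectrum m V" unfolding V_def by (rule split(1))
      fix U assume U: "subspace class_ring U (module_vec TYPE('a) m) \<and> (\<forall>M\<in>V. \<forall>X\<in>U. M *\<^sub>v X \<in> U)"
      show "U = {0\<^sub>v m} \<or> U = carrier_vec m"
      proof (rule ccontr)
        assume "\<not> ?thesis"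
        then obtain k Q T where k: "0 < k" "k < m" and QT: "inverse_mats m Q T"
          and QVT: "\<And>M i j. M \<in> V \<Longrightarrow> k \<le> i \<Longrightarrow> i < m \<Longrightarrow> j < k \<Longrightarrow> (Q * M * T) $$ (i, j) = 0"
          using stable_subspace_block_form[of U m V] U Vc by blast
        note QTc = QT[unfolded inverse_mats_def]
        \<comment> \<open>A proper nonzero stable subspace for \<open>V\<close> gives
          \<open>V\<close> a block form with a smaller first block \<open>k\<close>. Extending
          \<open>Q\<close> and \<open>T\<close> by the identity transfers it to all of
          \<open>H\<close>, against the leastness of \<open>m\<close>.\<close>
        let ?Q = "four_block_mat Q (0\<^sub>m m p) (0\<^sub>m p m) (1\<^sub>m p)"
          and ?T = "four_block_mat T (0\<^sub>m m p) (0\<^sub>m p m) (1\<^sub>m p)"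
        have diag: "inverse_mats n ?Q ?T" unfolding n by (rule inverse_mats_diag[OF QT inverse_mats_one])
        note diagc = diag[unfolded inverse_mats_def]
        have "((?Q * R) * M * (S * ?T)) $$ (i, j) = 0"
          if M: "M \<in> H" and i: "k \<le> i" "i < n" and j: "j < k" for M i j
        proof -
          have "R * M * S \<in> G" using M unfolding G_def by simp
          then obtain A B C where blocks: "R * M * S = four_block_mat A B (0\<^sub>m p m) C"
            and A: "A \<in> V" and B: "B \<in> carrier_mat m p" and C: "C \<in> W"
            unfolding join mat_join_def by auto
          have Ac: "A \<in> carrier_mat m m" and Cc: "C \<in> carrier_mat p p" using A C Vc Wc by auto
          have "(?Q * R) * M * (S * ?T) = ?Q * (R * M * S) * ?T"
            using mult_mult_assoc[of R n S ?Q ?T M] RSc diagc Hc[OF M] by simp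
          also have "\<dots> = four_block_mat (Q * A * T) (Q * B * 1\<^sub>m p) (0\<^sub>m p m) (1\<^sub>m p * C * 1\<^sub>m p)"
            unfolding blocks using QTc Ac B Cc by (intro conj_four_block) auto
          \<comment> \<open>For \<open>i < m\<close> this is the choice of \<open>Q\<close> and
            \<open>T\<close>; for larger \<open>i\<close> the entry lies in the zero block, as
            \<open>j < k < m\<close>.\<close>
          also have "\<dots> $$ (i, j) = 0"
            using QVT[OF A, of i j] i j k QTc Ac Cc unfolding n by (cases "i < m") auto
          finally show ?thesis .
        qed
        then have "?P k" using k m inverse_mats_mult[OF RS diag] by (intro conjI exI) auto
        then show False using least[OF k(2)] by blast
      qed
    qed
    \<comment> \<open>Positivity of \<open>m\<close> makes the induction hypothesis applicable;
      \<open>p\<close> may be 0, and then \<open>Vs\<close> is empty.\<close>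
    have "p < n" using m n by simp
    from less.IH[OF this, of W] obtain Vs :: "(nat \<times> 'a mat set) list"
      where Vs: "\<forall>(m, V)\<in>set Vs. m > 0 \<and> irreducible_maximal_trivial_spectrum m V"
        "sum_list (map fst Vs) = p" and sim: "similar_mat_sets p W (mat_joins Vs)"
      using split(2) unfolding W_def by blast
    then obtain Q T where QT: "inverse_mats p Q T" and QWT: "mat_joins Vs = (\<lambda>M. Q * M * T) ` W"
      unfolding similar_mat_sets_iff by blast
    \<comment> \<open>The conjugation that decomposes \<open>W\<close> is extended by the identity,
      so that \<open>V\<close> stays as it is.\<close>
    let ?Q = "four_block_mat (1\<^sub>m m) (0\<^sub>m m p) (0\<^sub>m p m) Q"
      and ?T = "four_block_mat (1\<^sub>m m) (0\<^sub>m m p) (0\<^sub>m p m) T"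
    have diag: "inverse_mats n ?Q ?T" unfolding n by (rule inverse_mats_diag[OF inverse_mats_one QT])
    note diagc = diag[unfolded inverse_mats_def]
    have "mat_joins ((m, V) # Vs) = (\<lambda>M. ?Q * M * ?T) ` G"
      using mat_join_conj[OF Vc Wc QT] unfolding mat_joins_Cons[OF Vc] Vs(2) QWT join by simp
    also have "\<dots> = (\<lambda>M. (?Q * R) * M * (S * ?T)) ` H"
      unfolding G_def image_image using RSc diagc Hc by (intro image_cong refl mult_mult_assoc) auto
    finally have "similar_mat_sets n H (mat_joins ((m, V) # Vs))"
      unfolding similar_mat_sets_iff using inverse_mats_mult[OF RS diag] by blast
    then show ?thesis using Vs m(1) irr n by (intro exI[of _ "(m, V) # Vs"]) auto
  qed
qed

end
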